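(* Let $B$ be the second Basilica group of the Grigorchuk--Erschler group. Then $B$ is regular branch over its commutator subgroup $B'$.
   Context: Let $T$ be the binary rooted tree with vertices the finite words over $X=\{0,1\}$ (root the empty word, each $v$ joined to $v0,v1$), and $\mathrm{Aut}\,T$ its group of root-fixing automorphisms, acting on the left. The section $g|_v$ of $g\in\mathrm{Aut}\,T$ at a vertex $v$ is defined by $g(vw)=g(v)g|_v(w)$. One writes $g=(g|_0,g|_1)\sigma$ with $\sigma\in\mathrm{Sym}(\{0,1\})$ the action on the first level; $(x,y)$ denotes the automorphism fixing $0,1$ with sections $x$ at $0$ and $y$ at $1$; $\tau$ is the transposition of $0$ and $1$. The second Basilica group $B$ of the Grigorchuk--Erschler group is the subgroup of $\mathrm{Aut}\,T$ generated by $a=(1,1)\tau$, $\alpha=(a,1)$, $c_0=(c_1,1)$, $c_1=(c_2,1)$, $c_2=(c_3,1)$, $c_3=(c_0,\alpha)$. A group $G\le\mathrm{Aut}\,T$ is self-similar if all sections of its elements lie in $G$, and spherically transitive if it acts transitively on each level $X^n$. A self-similar, spherically transitive group $G\le\mathrm{Aut}\,T$ is regular branch over a non-trivial subgroup $K\le G$ if $K$ has finite index in $G$ and $K\times K\le K$ in the sense that for all $x,y\in K$ the automorphism $(x,y)$ belongs to $K$. *)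

theory Defs
  imports "HOL-Algebra.Algebra"
begin

text \<open>Words over $X = \{0,1\}$ are boolean lists, with \<open>False\<close> for the letter 0 and
  \<open>True\<close> for the letter 1. The transposition of the two letters is \<open>Not\<close>.\<close>

type_synonym vertex = "bool list"

definition adjacent :: "vertex \<Rightarrow> vertex \<Rightarrow> bool" where
  "adjacent u v \<longleftrightarrow> (\<exists>x. v = u @ [x] \<or> u = v @ [x])"

definition AutT :: "(vertex \<Rightarrow> vertex) monoid" where
  "AutT = \<lparr>carrier = {g. bij g \<and> g [] = [] \<and> (\<forall>u v. adjacent (g u) (g v) \<longleftrightarrow> adjacent u v)},
           monoid.mult = (\<circ>), one = id\<rparr>"

definition sec :: "(vertex \<Rightarrow> vertex) \<Rightarrow> vertex \<Rightarrow> vertex \<Rightarrow> vertex" where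
  "sec g v = (THE h. \<forall>w. g (v @ w) = g v @ h w)"

text \<open>\<open>wreath x y s\<close> is $(x,y)s$: it has section \<open>x\<close> at 0, section \<open>y\<close> at 1 and acts on the
  first level by \<open>s\<close>. Thus $(x,y)$ is \<open>wreath x y id\<close>.\<close>

fun wreath :: "(vertex \<Rightarrow> vertex) \<Rightarrow> (vertex \<Rightarrow> vertex) \<Rightarrow> (bool \<Rightarrow> bool) \<Rightarrow> vertex \<Rightarrow> vertex" where
  "wreath x y s [] = []"
| "wreath x y s (False # w) = s False # x w"
| "wreath x y s (True # w) = s True # y w"

definition gen_a :: "vertex \<Rightarrow> vertex" where
  "gen_a = wreath id id Not"

definition gen_alpha :: "vertex \<Rightarrow> vertex" where
  "gen_alpha = wreath gen_a id id"

text \<open>The mutually recursive equations for the other four generators are unfolded on words here;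
  lemma \<open>gen_c_wreath\<close> recovers their wreath form.\<close>

fun gen_c0 gen_c1 gen_c2 gen_c3 :: "vertex \<Rightarrow> vertex" where
  "gen_c0 [] = []"
| "gen_c0 (False # w) = False # gen_c1 w"
| "gen_c0 (True # w) = True # w"
| "gen_c1 [] = []"
| "gen_c1 (False # w) = False # gen_c2 w"
| "gen_c1 (True # w) = True # w"
| "gen_c2 [] = []"
| "gen_c2 (False # w) = False # gen_c3 w"
| "gen_c2 (True # w) = True # w"
| "gen_c3 [] = []"
| "gen_c3 (False # w) = False # gen_c0 w"
| "gen_c3 (True # w) = True # gen_alpha w"

definition basilica2 :: "(vertex \<Rightarrow> vertex) set" where
  "basilica2 = generate AutT {gen_a, gen_alpha, gen_c0, gen_c1, gen_c2, gen_c3}"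

definition self_similar :: "(vertex \<Rightarrow> vertex) set \<Rightarrow> bool" where
  "self_similar G \<longleftrightarrow> (\<forall>g\<in>G. \<forall>v. sec g v \<in> G)"

definition spherically_transitive :: "(vertex \<Rightarrow> vertex) set \<Rightarrow> bool" where
  "spherically_transitive G \<longleftrightarrow>
     (\<forall>n u v. length u = n \<and> length v = n \<longrightarrow> (\<exists>g\<in>G. g u = v))"

definition regular_branch_over ::
    "(vertex \<Rightarrow> vertex) set \<Rightarrow> (vertex \<Rightarrow> vertex) set \<Rightarrow> bool" where
  "regular_branch_over G K \<longleftrightarrow>
     subgroup G AutT \<and> self_similar G \<and> spherically_transitive G \<and>
     subgroup K (AutT\<lparr>carrier := G\<rparr>) \<and> K \<noteq> {\<one>\<^bsub>AutT\<^esub>} \<and>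
     finite (rcosets\<^bsub>AutT\<lparr>carrier := G\<rparr>\<^esub> K) \<and>
     (\<forall>x\<in>K. \<forall>y\<in>K. wreath x y id \<in> K)"

lemma gen_c_wreath:
  "gen_c0 = wreath gen_c1 id id" "gen_c1 = wreath gen_c2 id id"
  "gen_c2 = wreath gen_c3 id id" "gen_c3 = wreath gen_c0 gen_alpha id"
proof -
  have "gen_c0 w = wreath gen_c1 id id w" for w
    by (cases "(gen_c1, id :: vertex \<Rightarrow> vertex, id :: bool \<Rightarrow> bool, w)" rule: wreath.cases) auto
  then show "gen_c0 = wreath gen_c1 id id" by blast
  have "gen_c1 w = wreath gen_c2 id id w" for w
    by (cases "(gen_c2, id :: vertex \<Rightarrow> vertex, id :: bool \<Rightarrow> bool, w)" rule: wreath.cases) auto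
  then show "gen_c1 = wreath gen_c2 id id" by blast
  have "gen_c2 w = wreath gen_c3 id id w" for w
    by (cases "(gen_c3, id :: vertex \<Rightarrow> vertex, id :: bool \<Rightarrow> bool, w)" rule: wreath.cases) auto
  then show "gen_c2 = wreath gen_c3 id id" by blast
  have "gen_c3 w = wreath gen_c0 gen_alpha id w" for w
    by (cases "(gen_c0, gen_alpha, id :: bool \<Rightarrow> bool, w)" rule: wreath.cases) auto
  then show "gen_c3 = wreath gen_c0 gen_alpha id" by blast
qed

lemma group_AutT: "group AutT"
proof (rule groupI)
  fix g assume g: "g \<in> carrier AutT"
  then have b: "bij g" by (simp add: AutT_def)
  define h where "h = inv_into UNIV g"
  have gh: "g (h u) = u" for u
    unfolding h_def using b by (simp add: bij_is_surj surj_f_inv_f)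
  have hg: "h (g u) = u" for u
    unfolding h_def using b by (simp add: bij_is_inj)
  have "g [] = []" using g by (simp add: AutT_def)
  then have "h [] = []" using hg[of "[]"] by simp
  moreover have "adjacent (h u) (h v) \<longleftrightarrow> adjacent u v" for u v
  proof -
    have "adjacent (g (h u)) (g (h v)) \<longleftrightarrow> adjacent (h u) (h v)"
      using g by (simp add: AutT_def)
    then show ?thesis by (simp add: gh)
  qed
  moreover have "bij h" unfolding h_def using b by (rule bij_imp_bij_inv)
  ultimately have "h \<in> carrier AutT" by (simp add: AutT_def)
  moreover have "h \<otimes>\<^bsub>AutT\<^esub> g = \<one>\<^bsub>AutT\<^esub>"
    using hg by (auto simp: AutT_def)
  ultimately show "\<exists>h\<in>carrier AutT. h \<otimes>\<^bsub>AutT\<^esub> g = \<one>\<^bsub>AutT\<^esub>" by blast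
qed (auto simp: AutT_def bij_comp comp_assoc)

lemma AutT_child:
  assumes "g \<in> carrier AutT"
  shows "\<exists>y. g (v @ [x]) = g v @ [y]"
proof -
  have adj: "adjacent (g u) (g v) \<longleftrightarrow> adjacent u v" for u v
    using assms by (simp add: AutT_def)
  show ?thesis
  proof (induction v arbitrary: x rule: rev_induct)
    case Nil
    have "g [] = []" using assms by (simp add: AutT_def)
    moreover have "adjacent (g []) (g [x])" by (simp add: adj) (simp add: adjacent_def)
    ultimately show ?case by (auto simp: adjacent_def)
  next
    case (snoc z u)
    have "adjacent (g (u @ [z])) (g (u @ [z, x]))"
      by (simp add: adj) (simp add: adjacent_def)
    then consider y where "g (u @ [z, x]) = g (u @ [z]) @ [y]"
      | y where "g (u @ [z]) = g (u @ [z, x]) @ [y]" by (auto simp: adjacent_def)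
    then show ?case
    proof cases
      case 2
      then have "g u = g (u @ [z, x])" using snoc[of z] by auto
      then have "u = u @ [z, x]" using assms by (auto simp: AutT_def bij_def dest: injD)
      then show ?thesis by simp
    qed auto
  qed
qed

lemma AutT_length:
  assumes "g \<in> carrier AutT"
  shows "length (g v) = length v"
proof (induction v rule: rev_induct)
  case Nil
  then show ?case using assms by (simp add: AutT_def)
next
  case (snoc x v)
  then show ?case using AutT_child[OF assms, of v x] by auto
qed

lemma AutT_section:
  assumes "g \<in> carrier AutT"
  shows "g (v @ w) = g v @ sec g v w"
proof -
  have "\<exists>h. g (v @ w) = g v @ h" for w
  proof (induction w rule: rev_induct)
    case (snoc x w)
    then show ?case using AutT_child[OF assms, of "v @ w" x] by auto
  qed simp
  then obtain h where h: "\<forall>w. g (v @ w) = g v @ h w" by metis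
  have "sec g v = h" unfolding sec_def by (rule the_equality) (use h in auto)
  then show ?thesis using h by simp
qed

lemma sec_wreath:
  assumes "x [] = []" "y [] = []"
  shows "sec (wreath x y s) [False] = x" "sec (wreath x y s) [True] = y"
  unfolding sec_def using assms by (auto intro!: the_equality)

lemma wreath_in_AutT:
  assumes x: "x \<in> carrier AutT" and y: "y \<in> carrier AutT" and s: "bij s"
  shows "wreath x y s \<in> carrier AutT"
proof -
  let ?g = "wreath x y s"
  have gCons: "?g (b # w) = s b # (if b then y else x) w" for b w by (cases b) auto
  have bx: "bij x" "bij y" and nil: "x [] = []" "y [] = []" using x y by (auto simp: AutT_def)
  have adjx: "adjacent (x u) (x v) \<longleftrightarrow> adjacent u v" "adjacent (y u) (y v) \<longleftrightarrow> adjacent u v" for u v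
    using x y by (auto simp: AutT_def)
  have "inj ?g"
  proof (rule injI)
    fix u v assume "?g u = ?g v"
    then show "u = v" using s bx
      by (cases u; cases v) (auto simp: gCons bij_def dest: injD split: if_splits)
  qed
  moreover have "surj ?g"
  proof (unfold surj_def, rule allI)
    fix v show "\<exists>u. v = ?g u"
    proof (cases v)
      case Nil
      then show ?thesis by (intro exI[of _ "[]"]) simp
    next
      case (Cons c w)
      obtain b where "c = s b" using s by (metis bij_pointE)
      moreover have "bij (if b then y else x)" using bx by simp
      then obtain w' where "w = (if b then y else x) w'" by (metis bij_pointE)
      ultimately show ?thesis using Cons gCons by (intro exI[of _ "b # w'"]) simp
    qed
  qed
  moreover have "adjacent (?g u) (?g v) \<longleftrightarrow> adjacent u v" for u v
  proof -
    have len: "length (x w) = length w" "length (y w) = length w" for w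
      using AutT_length[OF x] AutT_length[OF y] by auto
    have l: "x w = [] \<longleftrightarrow> w = []" "y w = [] \<longleftrightarrow> w = []" for w
      using len[of w] by (metis length_0_conv)+
    have a1: "adjacent [] (b # w) \<longleftrightarrow> w = []" "adjacent (b # w) [] \<longleftrightarrow> w = []" for b w
      by (auto simp: adjacent_def)
    have a2: "adjacent (b # w) (c # w') \<longleftrightarrow> b = c \<and> adjacent w w'" for b c w w'
      by (auto simp: adjacent_def)
    have si: "s b = s c \<longleftrightarrow> b = c" for b c using s by (auto simp: bij_def dest: injD)
    show ?thesis
      by (cases u; cases v) (auto simp: gCons a1 a2 l adjx si)
  qed
  ultimately show ?thesis by (simp add: AutT_def bij_def)
qed

end

theory Submission
  imports Defs
begin

text \<open>Write \<open>B\<close> for the group and \<open>[x, y]\<close> for \<open>x y x\<^sup>-\<^sup>1 y\<^sup>-\<^sup>1\<close>. All six generators are involutions, so the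
  abelianization of \<open>B\<close> is an abelian group generated by six involutions and hence finite; this is
  the finite index of \<open>B'\<close>.

  The heart of the matter is the inclusion \<open>B' \<times> B' \<le> B'\<close>. As \<open>a\<close> exchanges the two coordinates, it
  suffices to show \<open>(x, 1) \<in> B'\<close> for \<open>x \<in> B'\<close>. Every generator is the section at 0 of an element of
  \<open>B\<close> that fixes the first level:
  \<open>a, c\<^sub>1, c\<^sub>2, c\<^sub>3\<close> lift to \<open>\<alpha> = (a, 1)\<close>, \<open>c\<^sub>0 = (c\<^sub>1, 1)\<close>, \<open>c\<^sub>1 = (c\<^sub>2, 1)\<close>, \<open>c\<^sub>2 = (c\<^sub>3, 1)\<close>, while
  \<open>c\<^sub>0\<close> and \<open>\<alpha>\<close> lift to \<open>c\<^sub>3 = (c\<^sub>0, \<alpha>)\<close> and \<open>a c\<^sub>3 a = (\<alpha>, c\<^sub>0)\<close>.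
  Conjugating by such lifts shows that \<open>K = {x \<in> B. (x, 1) \<in> B'}\<close> is normal in \<open>B\<close>, so it is enough
  that \<open>K\<close> contains the commutator of any two generators. If one of the two lifts has trivial second
  coordinate, the commutator of the lifts is \<open>([s, t], 1)\<close> and there is nothing more to do. The only
  remaining pair is \<open>\<alpha>, c\<^sub>0\<close>. Here \<open>\<alpha> = (a, 1)\<close> commutes with \<open>a c\<^sub>0 a = (1, c\<^sub>1)\<close>, and \<open>c\<^sub>0\<close>
  is congruent to \<open>a c\<^sub>0 a\<close> modulo \<open>K\<close> because \<open>[a, c\<^sub>0] \<in> K\<close> by the previous case; hence
  \<open>[\<alpha>, c\<^sub>0] \<in> K\<close>.\<close>

section \<open>Commutator subgroups and generators\<close>

text \<open>In \<open>G / K\<close> the generators commute pairwise, so \<open>G / K\<close> is abelian. Elementwise, for fixed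
  \<open>t\<close> the elements that commute with \<open>t\<close> modulo \<open>K\<close> form a subgroup; this is applied first with
  \<open>t\<close> a generator and then with \<open>t\<close> arbitrary.\<close>

lemma (in group) derived_subset_of_commuting_generators:
  assumes gen: "generate G S = carrier G" and S: "S \<subseteq> carrier G" and K: "K \<lhd> G"
    and comm: "\<And>s t. s \<in> S \<Longrightarrow> t \<in> S \<Longrightarrow> s \<otimes> t \<otimes> inv s \<otimes> inv t \<in> K"
  shows "derived G (carrier G) \<subseteq> K"
proof -
  interpret K: normal K G by (rule K)
  have one_sided: "g \<otimes> t \<otimes> inv g \<otimes> inv t \<in> K"
    if t: "t \<in> carrier G" and st: "\<And>s. s \<in> S \<Longrightarrow> s \<otimes> t \<otimes> inv s \<otimes> inv t \<in> K"
      and g: "g \<in> carrier G" for g t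
  proof -
    have inverse: "inv h \<otimes> t \<otimes> h \<otimes> inv t \<in> K"
      if h: "h \<in> carrier G" and k: "h \<otimes> t \<otimes> inv h \<otimes> inv t \<in> K" for h
    proof -
      have "inv h \<otimes> inv (h \<otimes> t \<otimes> inv h \<otimes> inv t) \<otimes> h \<in> K"
        by (rule K.inv_op_closed1) (use h k in auto)
      also have "inv h \<otimes> inv (h \<otimes> t \<otimes> inv h \<otimes> inv t) \<otimes> h = inv h \<otimes> t \<otimes> h \<otimes> inv t"
        using h t by (simp add: inv_mult_group m_assoc)
      finally show ?thesis .
    qed
    have "g \<in> generate G S" using g gen by simp
    then show ?thesis
    proof induction
      case one
      then show ?case using t by simp
    next
      case (incl h)
      then show ?case by (rule st)
    next
      case (inv h)
      then show ?case using inverse[of h] st[of h] S by auto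
    next
      case (eng h1 h2)
      then have h: "h1 \<in> carrier G" "h2 \<in> carrier G" using gen by auto
      have "h1 \<otimes> (h2 \<otimes> t \<otimes> inv h2 \<otimes> inv t) \<otimes> inv h1 \<otimes> (h1 \<otimes> t \<otimes> inv h1 \<otimes> inv t) \<in> K"
        by (rule K.m_closed[OF K.inv_op_closed2[OF h(1) eng.IH(2)] eng.IH(1)])
      also have "h1 \<otimes> (h2 \<otimes> t \<otimes> inv h2 \<otimes> inv t) \<otimes> inv h1 \<otimes> (h1 \<otimes> t \<otimes> inv h1 \<otimes> inv t)
          = h1 \<otimes> h2 \<otimes> t \<otimes> inv (h1 \<otimes> h2) \<otimes> inv t"
        using h t by (simp add: inv_mult_group m_assoc inv_solve_left')
      finally show ?case .
    qed
  qed
  have swap: "t \<otimes> s \<otimes> inv t \<otimes> inv s \<in> K"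
    if "s \<otimes> t \<otimes> inv s \<otimes> inv t \<in> K" "s \<in> carrier G" "t \<in> carrier G" for s t
  proof -
    have "inv (s \<otimes> t \<otimes> inv s \<otimes> inv t) \<in> K" using that by blast
    then show ?thesis using that by (simp add: inv_mult_group m_assoc)
  qed
  have "g \<otimes> h \<otimes> inv g \<otimes> inv h \<in> K" if g: "g \<in> carrier G" and h: "h \<in> carrier G" for g h
  proof (rule one_sided)
    fix s assume s: "s \<in> S"
    have "h \<otimes> s \<otimes> inv h \<otimes> inv s \<in> K"
      by (rule one_sided) (use s S h comm in auto)
    then show "s \<otimes> h \<otimes> inv s \<otimes> inv h \<in> K" using swap s S h by blast
  qed (use g h in auto)
  then show ?thesis
    unfolding derived_def by (intro generate_subgroup_incl K.subgroup_axioms) auto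
qed

text \<open>Adjoining an involution \<open>x\<close> to the generators at most doubles an abelian group: \<open>H \<union> x H\<close> is
  already closed under multiplication.\<close>

lemma (in comm_group) finite_generate_involutions:
  assumes "finite S" "S \<subseteq> carrier G" "\<And>s. s \<in> S \<Longrightarrow> s \<otimes> s = \<one>"
  shows "finite (generate G S)"
  using assms
proof (induction S)
  case empty
  then show ?case by (simp add: generate_empty)
next
  case (insert x S)
  let ?H = "generate G S"
  have x: "x \<in> carrier G" "x \<otimes> x = \<one>" and S: "S \<subseteq> carrier G" using insert.prems by auto
  have self_inv: "inv s = s" if "s \<in> insert x S" for s
    using that insert.prems by (metis inv_equality subsetD)
  have car: "h \<in> carrier G" if "h \<in> ?H" for h
    using that S generate_in_carrier by blast
  have xx: "x \<otimes> (x \<otimes> z) = z" if "z \<in> carrier G" for z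
    using that x by (metis m_assoc l_one)
  have "g \<in> ?H \<union> (\<otimes>) x ` ?H" if "g \<in> generate G (insert x S)" for g
    using that
  proof induction
    case one
    then show ?case by (simp add: generate.one)
  next
    case (incl h)
    then show ?case using x generate.one[of G S] by (force intro: generate.incl)
  next
    case (inv h)
    then show ?case using self_inv[of h] x generate.one[of G S] by (force intro: generate.incl)
  next
    case (eng h1 h2)
    obtain y z i j where y: "y \<in> ?H" "h1 = (if i then y else x \<otimes> y)"
      and z: "z \<in> ?H" "h2 = (if j then z else x \<otimes> z)"
    proof -
      have "\<exists>y i. y \<in> ?H \<and> h = (if i then y else x \<otimes> y)" if "h \<in> ?H \<union> (\<otimes>) x ` ?H" for h
        using that by (metis (full_types) UnE imageE)
      then show ?thesis using eng.IH that by metis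
    qed
    have c: "y \<in> carrier G" "z \<in> carrier G" using y z car by auto
    have "y \<otimes> z \<in> ?H" using y z by (simp add: generate.eng)
    moreover have "h1 \<otimes> h2 = (if i = j then y \<otimes> z else x \<otimes> (y \<otimes> z))"
    proof -
      have "x \<otimes> y \<otimes> (x \<otimes> z) = y \<otimes> z"
        using c x xx[of "y \<otimes> z"] by (simp add: m_ac)
      then show ?thesis using c x y(2) z(2) by (auto simp: m_ac)
    qed
    ultimately show ?case by auto
  qed
  moreover have "finite (?H \<union> (\<otimes>) x ` ?H)"
    using insert S by auto
  ultimately show ?case by (meson finite_subset subsetI)
qed

text \<open>The cosets of the commutator subgroup form the abelianization, which is generated by the
  images of the generators and so by finitely many involutions.\<close>

lemma (in group) finite_rcosets_derived:
  assumes gen: "generate G S = carrier G" and S: "finite S" "S \<subseteq> carrier G"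
    and invol: "\<And>s. s \<in> S \<Longrightarrow> s \<otimes> s = \<one>"
  shows "finite (rcosets (derived G (carrier G)))"
proof -
  let ?D = "derived G (carrier G)"
  interpret D: normal ?D G by (rule derived_self_is_normal)
  interpret Q: comm_group "G Mod ?D" by (rule derived_quot_is_comm_group)
  interpret p: group_hom G "G Mod ?D" "\<lambda>g. ?D #> g"
    by unfold_locales (rule D.r_coset_hom_Mod)
  have "finite (generate (G Mod ?D) ((\<lambda>g. ?D #> g) ` S))"
  proof (rule Q.finite_generate_involutions)
    fix q assume "q \<in> (\<lambda>g. ?D #> g) ` S"
    then obtain s where s: "s \<in> S" "q = ?D #> s" by blast
    then have "q \<otimes>\<^bsub>G Mod ?D\<^esub> q = ?D #> (s \<otimes> s)"
      using S p.hom_mult[of s s] by auto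
    then show "q \<otimes>\<^bsub>G Mod ?D\<^esub> q = \<one>\<^bsub>G Mod ?D\<^esub>"
      using invol s p.hom_one by simp
  qed (use S p.hom_closed in auto)
  also have "generate (G Mod ?D) ((\<lambda>g. ?D #> g) ` S) = (\<lambda>g. ?D #> g) ` carrier G"
    using p.generate_img[OF S(2)] gen by simp
  also have "\<dots> = rcosets ?D" by (auto simp: RCOSETS_def)
  finally show ?thesis .
qed

section \<open>Wreath recursion\<close>

interpretation AutT: group AutT by (rule group_AutT)

lemma AutT_simps [simp]: "x \<otimes>\<^bsub>AutT\<^esub> y = x \<circ> y" "\<one>\<^bsub>AutT\<^esub> = id"
  by (simp_all add: AutT_def)

lemma wreath_Cons: "wreath x y s (b # w) = s b # (if b then y else x) w"
  by (cases b) auto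

lemma wreath_comp:
  "wreath x y s \<circ> wreath x' y' s'
    = wreath ((if s' False then y else x) \<circ> x') ((if s' True then y else x) \<circ> y') (s \<circ> s')"
proof
  fix w show "(wreath x y s \<circ> wreath x' y' s') w
    = wreath ((if s' False then y else x) \<circ> x') ((if s' True then y else x) \<circ> y') (s \<circ> s') w"
    by (cases w) (auto simp: wreath_Cons)
qed

lemma wreath_id [simp]: "wreath id id id = id"
proof
  fix w show "wreath id id id w = id w" by (cases w) (auto simp: wreath_Cons)
qed

lemma AutT_nil: "g \<in> carrier AutT \<Longrightarrow> g [] = []"
  by (simp add: AutT_def)

lemma sec_eqI:
  assumes "\<And>w. g (v @ w) = g v @ h w"
  shows "sec g v = h"
  unfolding sec_def by (rule the_equality) (use assms in auto)

lemma sec_nil: "g \<in> carrier AutT \<Longrightarrow> sec g [] = g"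
  by (rule sec_eqI) (simp add: AutT_nil)

lemma sec_Cons:
  assumes g: "g \<in> carrier AutT" and h: "sec g [b] \<in> carrier AutT"
  shows "sec g (b # v) = sec (sec g [b]) v"
proof (rule sec_eqI)
  fix w
  have "g (b # v @ w) = g [b] @ sec g [b] (v @ w)"
    using AutT_section[OF g, of "[b]" "v @ w"] by simp
  also have "\<dots> = g [b] @ sec g [b] v @ sec (sec g [b]) v w"
    using AutT_section[OF h, of v w] by simp
  also have "\<dots> = g (b # v) @ sec (sec g [b]) v w"
    using AutT_section[OF g, of "[b]" v] by simp
  finally show "g ((b # v) @ w) = g (b # v) @ sec (sec g [b]) v w" by simp
qed

section \<open>The generators\<close>

abbreviation gens :: "(vertex \<Rightarrow> vertex) set" where
  "gens \<equiv> {gen_a, gen_alpha, gen_c0, gen_c1, gen_c2, gen_c3}"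

lemma gen_a_invol: "gen_a \<circ> gen_a = id"
  by (simp add: gen_a_def wreath_comp comp_def[of Not] flip: id_def)

lemma gen_alpha_invol: "gen_alpha \<circ> gen_alpha = id"
  by (simp add: gen_alpha_def wreath_comp gen_a_invol)

lemma gen_c_invol:
  "gen_c0 \<circ> gen_c0 = id" "gen_c1 \<circ> gen_c1 = id" "gen_c2 \<circ> gen_c2 = id" "gen_c3 \<circ> gen_c3 = id"
proof -
  have alpha: "gen_alpha (gen_alpha w) = w" for w
    using gen_alpha_invol by (metis comp_apply id_apply)
  have "gen_c0 (gen_c0 w) = w \<and> gen_c1 (gen_c1 w) = w \<and>
        gen_c2 (gen_c2 w) = w \<and> gen_c3 (gen_c3 w) = w" for w
  proof (induction w)
    case (Cons b w)
    then show ?case by (cases b) (simp_all add: alpha)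
  qed simp
  then show "gen_c0 \<circ> gen_c0 = id" "gen_c1 \<circ> gen_c1 = id"
    "gen_c2 \<circ> gen_c2 = id" "gen_c3 \<circ> gen_c3 = id" by auto
qed

lemma gens_invol: "s \<in> gens \<Longrightarrow> s \<circ> s = id"
  using gen_a_invol gen_alpha_invol gen_c_invol by auto

text \<open>A map that sends children to children preserves adjacency in one direction; for an involution
  the other direction is obtained by applying the map again.\<close>

lemma involution_in_AutT:
  assumes invol: "g \<circ> g = id" and nil: "g [] = []" and child: "\<And>v x. \<exists>y. g (v @ [x]) = g v @ [y]"
  shows "g \<in> carrier AutT"
proof -
  have gg: "g (g v) = v" for v using invol by (metis comp_apply id_apply)
  have "adjacent (g u) (g v)" if "adjacent u v" for u v
    using that child unfolding adjacent_def by metis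
  then have "adjacent (g u) (g v) \<longleftrightarrow> adjacent u v" for u v using gg by metis
  moreover have "bij g" using invol by (rule o_bij) (rule invol)
  ultimately show ?thesis using nil by (simp add: AutT_def)
qed

lemma gens_in_AutT: "gens \<subseteq> carrier AutT"
proof -
  have id: "id \<in> carrier AutT" using AutT.one_closed by simp
  have Not: "bij Not" by (rule o_bij[of Not]) auto
  have a: "gen_a \<in> carrier AutT" unfolding gen_a_def by (intro wreath_in_AutT id Not)
  have alpha: "gen_alpha \<in> carrier AutT"
    unfolding gen_alpha_def by (intro wreath_in_AutT id a) auto
  have child: "(\<forall>x. \<exists>y. gen_c0 (v @ [x]) = gen_c0 v @ [y]) \<and>
      (\<forall>x. \<exists>y. gen_c1 (v @ [x]) = gen_c1 v @ [y]) \<and>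
      (\<forall>x. \<exists>y. gen_c2 (v @ [x]) = gen_c2 v @ [y]) \<and>
      (\<forall>x. \<exists>y. gen_c3 (v @ [x]) = gen_c3 v @ [y])" for v
  proof (induction v)
    case Nil
    have "gen_c0 [x] = [x] \<and> gen_c1 [x] = [x] \<and> gen_c2 [x] = [x] \<and> gen_c3 [x] = [x]" for x
      by (cases x) (simp_all add: AutT_nil[OF alpha])
    then show ?case by simp
  next
    case (Cons b v)
    then show ?case using AutT_child[OF alpha] by (cases b) auto
  qed
  show ?thesis using a alpha child gen_c_invol by (auto intro!: involution_in_AutT)
qed

lemma gens_inv: "s \<in> gens \<Longrightarrow> inv\<^bsub>AutT\<^esub> s = s"
  using gens_invol gens_in_AutT AutT.inv_equality[of s s] by auto

section \<open>Self-similarity and transitivity\<close>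

lemma subgroup_basilica2: "subgroup basilica2 AutT"
  unfolding basilica2_def by (rule AutT.generate_is_subgroup[OF gens_in_AutT])

lemma basilica2_in_AutT: "g \<in> basilica2 \<Longrightarrow> g \<in> carrier AutT"
  using subgroup.mem_carrier[OF subgroup_basilica2] .

lemma basilica2_gen: "s \<in> gens \<Longrightarrow> s \<in> basilica2"
  unfolding basilica2_def by (rule generate.incl)

lemma basilica2_id: "id \<in> basilica2"
  using subgroup.one_closed[OF subgroup_basilica2] by simp

lemma basilica2_comp: "g \<in> basilica2 \<Longrightarrow> h \<in> basilica2 \<Longrightarrow> g \<circ> h \<in> basilica2"
  using subgroup.m_closed[OF subgroup_basilica2] by simp

text \<open>As the generators are their own inverses, \<open>B\<close> is already generated by them as a monoid.\<close>

lemma basilica2_induct [consumes 1, case_names id gen comp]: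
  assumes "g \<in> basilica2" and "P id" and "\<And>s. s \<in> gens \<Longrightarrow> P s"
    and "\<And>g h. g \<in> basilica2 \<Longrightarrow> h \<in> basilica2 \<Longrightarrow> P g \<Longrightarrow> P h \<Longrightarrow> P (g \<circ> h)"
  shows "P g"
  using assms(1) unfolding basilica2_def
proof induction
  case one
  then show ?case using assms(2) by (simp only: AutT_simps)
next
  case (incl h)
  then show ?case by (rule assms(3))
next
  case (inv h)
  then show ?case using assms(3) gens_inv by simp
next
  case (eng h1 h2)
  then show ?case using assms(4) by (simp only: basilica2_def AutT_simps)
qed

lemma basilica2_decompose:
  assumes "g \<in> basilica2"
  shows "\<exists>x\<in>basilica2. \<exists>y\<in>basilica2. \<exists>s. g = wreath x y s"
  using assms
proof (induction rule: basilica2_induct)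
  case id
  then show ?case using wreath_id basilica2_id by metis
next
  case (gen s)
  have "gen_a \<in> basilica2" "gen_alpha \<in> basilica2" "gen_c0 \<in> basilica2" "gen_c1 \<in> basilica2"
    "gen_c2 \<in> basilica2" "gen_c3 \<in> basilica2" by (simp_all add: basilica2_gen)
  then show ?case using gen basilica2_id gen_a_def gen_alpha_def gen_c_wreath
    by (elim insertE emptyE) metis+
next
  case (comp g h)
  obtain x y s where "x \<in> basilica2" "y \<in> basilica2" "g = wreath x y s"
    using comp.IH(1) by blast
  moreover obtain x' y' s' where "x' \<in> basilica2" "y' \<in> basilica2" "h = wreath x' y' s'"
    using comp.IH(2) by blast
  ultimately have "g \<circ> h = wreath ((if s' False then y else x) \<circ> x')
      ((if s' True then y else x) \<circ> y') (s \<circ> s')"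
    and "(if s' False then y else x) \<circ> x' \<in> basilica2"
    and "(if s' True then y else x) \<circ> y' \<in> basilica2"
    by (simp_all only: wreath_comp) (simp_all add: basilica2_comp)
  then show ?case by (intro bexI exI)
qed

lemma self_similar_basilica2: "self_similar basilica2"
proof -
  have letter: "sec g [b] \<in> basilica2" if "g \<in> basilica2" for g b
  proof -
    obtain x y s where "x \<in> basilica2" "y \<in> basilica2" "g = wreath x y s"
      using basilica2_decompose \<open>g \<in> basilica2\<close> by metis
    then show ?thesis
      using sec_wreath[of x y s] by (cases b) (simp_all add: AutT_nil basilica2_in_AutT)
  qed
  have "sec g v \<in> basilica2" if "g \<in> basilica2" for g v
    using that
  proof (induction v arbitrary: g)
    case Nil
    then show ?case by (simp add: sec_nil basilica2_in_AutT)
  next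
    case (Cons b v)
    have "sec g (b # v) = sec (sec g [b]) v"
      by (intro sec_Cons basilica2_in_AutT letter Cons.prems)
    then show ?case using Cons letter[of g b] by metis
  qed
  then show ?thesis by (simp add: self_similar_def)
qed

lemma conj_gen_a: "gen_a \<circ> wreath x y id \<circ> gen_a = wreath y x id"
  by (simp add: gen_a_def wreath_comp comp_def[of Not] flip: id_def)

text \<open>The second coordinates of these lifts are involutions, so that the lifts are involutions
  as well.\<close>

lemma gens_lift:
  assumes "t \<in> gens"
  shows "\<exists>y\<in>carrier AutT. y \<circ> y = id \<and> wreath t y id \<in> basilica2"
proof -
  have B: "gen_a \<in> basilica2" "gen_alpha \<in> basilica2" "gen_c0 \<in> basilica2" "gen_c1 \<in> basilica2"
    "gen_c2 \<in> basilica2" "gen_c3 \<in> basilica2" by (simp_all add: basilica2_gen)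
  have id: "id \<in> carrier AutT" using AutT.one_closed by simp
  have "wreath gen_alpha gen_c0 id = gen_a \<circ> gen_c3 \<circ> gen_a"
    by (simp add: gen_c_wreath(4) conj_gen_a)
  then have alpha: "wreath gen_alpha gen_c0 id \<in> basilica2"
    using B by (simp add: basilica2_comp)
  consider "t = gen_alpha" | "t = gen_c0" | "t \<in> {gen_a, gen_c1, gen_c2, gen_c3}"
    using assms by blast
  then show ?thesis
  proof cases
    case 1
    then show ?thesis using alpha gen_c_invol(1) gens_in_AutT by blast
  next
    case 2
    then show ?thesis using B gen_c_wreath(4) gen_alpha_invol gens_in_AutT by auto
  next
    case 3
    then have "wreath t id id \<in> basilica2"
      using B gen_alpha_def gen_c_wreath by auto
    then show ?thesis using id by (intro bexI[of _ id]) auto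
  qed
qed

lemma basilica2_lift:
  assumes "g \<in> basilica2"
  shows "\<exists>y\<in>carrier AutT. wreath g y id \<in> basilica2"
  using assms
proof (induction rule: basilica2_induct)
  case id
  then show ?case using wreath_id basilica2_id basilica2_in_AutT by metis
next
  case (gen s)
  then show ?case using gens_lift by blast
next
  case (comp g h)
  then obtain y z where y: "y \<in> carrier AutT" "wreath g y id \<in> basilica2"
    and z: "z \<in> carrier AutT" "wreath h z id \<in> basilica2" by blast
  have "wreath g y id \<circ> wreath h z id = wreath (g \<circ> h) (y \<circ> z) id"
    by (simp add: wreath_comp)
  then have "wreath (g \<circ> h) (y \<circ> z) id \<in> basilica2" using y z by (metis basilica2_comp)
  moreover have "y \<circ> z \<in> carrier AutT" using AutT.m_closed[OF y(1) z(1)] by simp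
  ultimately show ?case by blast
qed

text \<open>Transport both vertices into the subtree at 0 with \<open>a\<close>, then act inside that subtree by a
  lift.\<close>

lemma spherically_transitive_basilica2: "spherically_transitive basilica2"
proof -
  have a: "gen_a \<in> basilica2" by (simp add: basilica2_gen)
  have move: "\<exists>h\<in>basilica2. \<forall>w. h (b # w) = c # w" for b c
  proof (cases "b = c")
    case True
    then show ?thesis using basilica2_id by (intro bexI[of _ id]) auto
  next
    case False
    then show ?thesis using a by (intro bexI[of _ gen_a]) (auto simp: gen_a_def wreath_Cons)
  qed
  have "\<exists>g\<in>basilica2. g u = v" if "length u = length v" for u v
    using that
  proof (induction u v rule: list_induct2)
    case Nil
    then show ?case using basilica2_id by (intro bexI[of _ id]) auto
  next
    case (Cons b u c v)
    then obtain g y where g: "g u = v" "wreath g y id \<in> basilica2"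
      using basilica2_lift by blast
    obtain h k where h: "h \<in> basilica2" "h (b # u) = False # u"
      and k: "k \<in> basilica2" "k (False # v) = c # v" using move by metis
    have "(k \<circ> (wreath g y id \<circ> h)) (b # u) = c # v" using g h k by simp
    moreover have "k \<circ> (wreath g y id \<circ> h) \<in> basilica2"
      using g h k by (simp add: basilica2_comp)
    ultimately show ?case by blast
  qed
  then show ?thesis by (auto simp: spherically_transitive_def)
qed

section \<open>The commutator subgroup\<close>

abbreviation basilica2_group :: "(vertex \<Rightarrow> vertex) monoid" where
  "basilica2_group \<equiv> AutT\<lparr>carrier := basilica2\<rparr>"

interpretation B: group basilica2_group
  by (rule AutT.subgroup_imp_group[OF subgroup_basilica2])

lemma B_inv: "g \<in> basilica2 \<Longrightarrow> inv\<^bsub>basilica2_group\<^esub> g = inv\<^bsub>AutT\<^esub> g"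
  by (rule AutT.m_inv_consistent[OF subgroup_basilica2])

lemma derived_normal: "derived AutT basilica2 \<lhd> basilica2_group"
  by (rule AutT.derived_subgroup_is_normal[OF subgroup_basilica2])

interpretation D: normal "derived AutT basilica2" basilica2_group
  by (rule derived_normal)

lemma derived_B: "derived basilica2_group (carrier basilica2_group) = derived AutT basilica2"
  using AutT.derived_consistent[OF order_refl subgroup_basilica2] by simp

lemma generate_B: "generate basilica2_group gens = carrier basilica2_group"
  using AutT.generate_consistent[OF _ subgroup_basilica2, of gens] basilica2_gen
  by (auto simp: basilica2_def)

lemma involution_inv:
  assumes "g \<in> basilica2" "g \<circ> g = id"
  shows "inv\<^bsub>AutT\<^esub> g = g"
  using AutT.inv_equality[of g g] assms basilica2_in_AutT by auto

lemma involutions_commutator_in_derived: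
  assumes "g \<in> basilica2" "h \<in> basilica2" "g \<circ> g = id" "h \<circ> h = id"
  shows "g \<circ> h \<circ> g \<circ> h \<in> derived AutT basilica2"
proof -
  have "g \<circ> h \<circ> g \<circ> h = g \<otimes>\<^bsub>AutT\<^esub> h \<otimes>\<^bsub>AutT\<^esub> inv\<^bsub>AutT\<^esub> g \<otimes>\<^bsub>AutT\<^esub> inv\<^bsub>AutT\<^esub> h"
    using assms by (simp add: involution_inv)
  then show ?thesis
    unfolding derived_def using assms(1,2) by (intro generate.incl) blast
qed

text \<open>The witness is \<open>[a, \<alpha>] = (a, a)\<close>.\<close>

lemma derived_nontrivial: "derived AutT basilica2 \<noteq> {id}"
proof
  assume triv: "derived AutT basilica2 = {id}"
  have "gen_a \<circ> gen_alpha \<circ> gen_a \<circ> gen_alpha \<in> derived AutT basilica2"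
    by (intro involutions_commutator_in_derived) (auto simp: basilica2_gen gens_invol)
  moreover have "(gen_a \<circ> gen_alpha \<circ> gen_a \<circ> gen_alpha) [False, False] = [False, True]"
    by (simp add: gen_a_def gen_alpha_def)
  ultimately show False using triv by auto
qed

lemma finite_index_derived: "finite (rcosets\<^bsub>basilica2_group\<^esub> (derived AutT basilica2))"
proof -
  have "finite (rcosets\<^bsub>basilica2_group\<^esub> (derived basilica2_group (carrier basilica2_group)))"
    by (rule B.finite_rcosets_derived[OF generate_B])
      (use gens_invol basilica2_gen in auto)
  then show ?thesis unfolding derived_B .
qed

section \<open>Branching\<close>

text \<open>The group \<open>K\<close> of the introduction.\<close>

definition left_branch :: "(vertex \<Rightarrow> vertex) set" where
  "left_branch = {x \<in> basilica2. wreath x id id \<in> derived AutT basilica2}"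

lemma left_embedding_hom: "group_hom AutT AutT (\<lambda>x. wreath x id id)"
proof unfold_locales
  have "id \<in> carrier AutT" using AutT.one_closed by simp
  then show "(\<lambda>x. wreath x id id) \<in> hom AutT AutT"
    by (intro homI) (auto simp: wreath_comp intro!: wreath_in_AutT)
qed

text \<open>For a lift \<open>(g, y)\<close> of \<open>g\<close>, conjugating \<open>(h, 1)\<close> by \<open>(g, y)\<close> gives \<open>(g h g\<^sup>-\<^sup>1, 1)\<close>, whatever
  \<open>y\<close> is, and \<open>B'\<close> is normal.\<close>

lemma left_branch_normal: "left_branch \<lhd> basilica2_group"
proof (rule B.normal_invI)
  interpret l: group_hom AutT AutT "\<lambda>x. wreath x id id" by (rule left_embedding_hom)
  show "subgroup left_branch basilica2_group"
  proof (rule B.subgroupI)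
    show "left_branch \<noteq> {}"
      using basilica2_id D.one_closed by (auto simp: left_branch_def)
  next
    fix x assume "x \<in> left_branch"
    then have x: "x \<in> basilica2" "wreath x id id \<in> derived AutT basilica2"
      by (auto simp: left_branch_def)
    have "wreath x id id \<in> basilica2" using D.mem_carrier[OF x(2)] by simp
    then have "inv\<^bsub>AutT\<^esub> (wreath x id id) \<in> derived AutT basilica2"
      using D.m_inv_closed[OF x(2)] by (simp only: B_inv)
    then have "wreath (inv\<^bsub>AutT\<^esub> x) id id \<in> derived AutT basilica2"
      using l.hom_inv basilica2_in_AutT x by simp
    then show "inv\<^bsub>basilica2_group\<^esub> x \<in> left_branch"
      using x B.inv_closed[of x] by (simp add: left_branch_def B_inv)
  next
    fix x y assume "x \<in> left_branch" "y \<in> left_branch"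
    then show "x \<otimes>\<^bsub>basilica2_group\<^esub> y \<in> left_branch"
      using D.m_closed[of "wreath x id id" "wreath y id id"]
      by (auto simp: left_branch_def wreath_comp basilica2_comp)
  qed (auto simp: left_branch_def)
next
  fix h g assume "h \<in> left_branch" and "g \<in> carrier basilica2_group"
  then have h: "h \<in> basilica2" "wreath h id id \<in> derived AutT basilica2" and g: "g \<in> basilica2"
    by (auto simp: left_branch_def)
  let ?c = "g \<otimes>\<^bsub>basilica2_group\<^esub> h \<otimes>\<^bsub>basilica2_group\<^esub> inv\<^bsub>basilica2_group\<^esub> g"
  have c: "?c \<in> basilica2"
    using g h B.inv_closed[of g] by (simp add: basilica2_comp)
  have cg: "?c \<circ> g = g \<circ> h"
    using B.inv_solve_right[of ?c "g \<circ> h" g] B.inv_closed[of g] g h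
    by (simp add: basilica2_comp)
  obtain y where y: "y \<in> carrier AutT" "wreath g y id \<in> basilica2"
    using basilica2_lift[OF g] by blast
  let ?L = "wreath g y id"
  have L: "?L \<in> carrier AutT" using y basilica2_in_AutT by blast
  have "?L \<circ> wreath h id id \<circ> inv\<^bsub>AutT\<^esub> ?L \<in> derived AutT basilica2"
    using D.inv_op_closed2[of ?L "wreath h id id"] y(2) h by (simp add: B_inv)
  \<comment> \<open>Comparing after multiplication by the lift avoids computing its inverse.\<close>
  moreover have "wreath ?c id id \<circ> ?L = ?L \<circ> wreath h id id"
    using cg by (simp add: wreath_comp)
  then have "wreath ?c id id = ?L \<circ> wreath h id id \<circ> inv\<^bsub>AutT\<^esub> ?L"
    using AutT.inv_solve_right[of "wreath ?c id id" "?L \<circ> wreath h id id" ?L] L h g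
      AutT.m_closed[of ?L "wreath h id id"] group_hom.hom_closed[OF left_embedding_hom, of ?c] basilica2_in_AutT[OF c]
      group_hom.hom_closed[OF left_embedding_hom, of h] basilica2_in_AutT[OF h(1)]
    by simp
  ultimately show "?c \<in> left_branch"
    using c by (simp add: left_branch_def)
qed

interpretation K: normal left_branch basilica2_group
  by (rule left_branch_normal)

lemma left_branch_comp: "g \<in> left_branch \<Longrightarrow> h \<in> left_branch \<Longrightarrow> g \<circ> h \<in> left_branch"
  using K.m_closed by simp

lemma left_branch_conj:
  assumes "g \<in> basilica2" "g \<circ> g = id" "h \<in> left_branch"
  shows "g \<circ> h \<circ> g \<in> left_branch"
  using K.inv_op_closed2[of g h] assms by (simp add: B_inv involution_inv)

text \<open>The lift of \<open>s\<close> is \<open>(s, 1)\<close>, so second coordinates cancel in the commutator with any lift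
  of \<open>t\<close>.\<close>

lemma generic_commutators_in_left_branch:
  assumes s: "s \<in> {gen_a, gen_c1, gen_c2, gen_c3}" and t: "t \<in> gens"
  shows "s \<circ> t \<circ> s \<circ> t \<in> left_branch"
proof -
  have "wreath s id id \<in> gens" using s gen_alpha_def gen_c_wreath by auto
  then have ls: "wreath s id id \<in> basilica2" by (rule basilica2_gen)
  obtain y where y: "y \<circ> y = id" "wreath t y id \<in> basilica2" using gens_lift[OF t] by blast
  have inv: "s \<circ> s = id" "t \<circ> t = id" using s t gens_invol by auto
  have "wreath s id id \<circ> wreath t y id \<circ> wreath s id id \<circ> wreath t y id \<in> derived AutT basilica2"
    using ls y inv by (intro involutions_commutator_in_derived) (auto simp: wreath_comp)
  then have "wreath (s \<circ> t \<circ> s \<circ> t) id id \<in> derived AutT basilica2"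
    using y by (simp add: wreath_comp)
  moreover have "s \<in> basilica2" "t \<in> basilica2" using s t basilica2_gen by auto
  ultimately show ?thesis by (simp add: left_branch_def basilica2_comp)
qed

lemma commutator_flip_in_left_branch:
  assumes "s \<in> gens" "t \<in> gens" "s \<circ> t \<circ> s \<circ> t \<in> left_branch"
  shows "t \<circ> s \<circ> t \<circ> s \<in> left_branch"
proof -
  have st: "s \<circ> s = id" "t \<circ> t = id" "s \<in> basilica2" "t \<in> basilica2"
    using assms(1,2) gens_invol basilica2_gen by blast+
  have B: "s \<circ> t \<circ> s \<circ> t \<in> basilica2" "t \<circ> s \<circ> t \<circ> s \<in> basilica2"
    using st by (simp_all add: basilica2_comp)
  have "(t \<circ> s \<circ> t \<circ> s) \<circ> (s \<circ> t \<circ> s \<circ> t) = id"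
    using st by (simp add: fun_eq_iff)
  then have "inv\<^bsub>basilica2_group\<^esub> (s \<circ> t \<circ> s \<circ> t) = t \<circ> s \<circ> t \<circ> s"
    using B.inv_equality[of "t \<circ> s \<circ> t \<circ> s" "s \<circ> t \<circ> s \<circ> t"] B by simp
  then show ?thesis using K.m_inv_closed[OF assms(3)] by simp
qed

text \<open>With \<open>d = a c\<^sub>0 a = (1, c\<^sub>1)\<close> and \<open>k = d c\<^sub>0 = [a, c\<^sub>0]\<close>, the involution \<open>c\<^sub>0\<close> equals \<open>d k\<close> and
  \<open>k\<^sup>-\<^sup>1 d\<close>. Since \<open>\<alpha>\<close> and \<open>d\<close> commute, this gives
  \<open>[\<alpha>, c\<^sub>0] = d (\<alpha> k \<alpha> \<cdot> k\<^sup>-\<^sup>1) d\<close>.\<close>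

lemma alpha_c0_commutator_in_left_branch:
  "gen_alpha \<circ> gen_c0 \<circ> gen_alpha \<circ> gen_c0 \<in> left_branch"
proof -
  define d where "d = gen_a \<circ> gen_c0 \<circ> gen_a"
  have B: "gen_a \<in> basilica2" "gen_c0 \<in> basilica2" "gen_alpha \<in> basilica2" "d \<in> basilica2"
    unfolding d_def by (simp_all add: basilica2_comp basilica2_gen)
  have d: "d = wreath id gen_c1 id"
    by (simp add: d_def gen_c_wreath(1) conj_gen_a)
  have dd: "d \<circ> d = id" by (simp add: d wreath_comp gen_c_invol)
  have comm: "gen_alpha \<circ> d = d \<circ> gen_alpha" by (simp add: d gen_alpha_def wreath_comp)
  have k: "d \<circ> gen_c0 \<in> left_branch"
    unfolding d_def by (rule generic_commutators_in_left_branch) auto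
  have "gen_c0 \<circ> gen_a \<circ> gen_c0 \<circ> gen_a \<in> left_branch"
    by (rule commutator_flip_in_left_branch, simp, simp, rule generic_commutators_in_left_branch) auto
  then have k': "gen_c0 \<circ> d \<in> left_branch" by (simp add: d_def comp_assoc)
  have "d \<circ> (gen_alpha \<circ> (d \<circ> gen_c0) \<circ> gen_alpha \<circ> (gen_c0 \<circ> d)) \<circ> d \<in> left_branch"
    by (intro left_branch_conj left_branch_comp k k' B dd gen_alpha_invol)
  also have "d \<circ> (gen_alpha \<circ> (d \<circ> gen_c0) \<circ> gen_alpha \<circ> (gen_c0 \<circ> d)) \<circ> d
      = gen_alpha \<circ> gen_c0 \<circ> gen_alpha \<circ> gen_c0"
    using dd comm by (simp add: fun_eq_iff)
  finally show ?thesis .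
qed

lemma derived_subset_left_branch: "derived AutT basilica2 \<subseteq> left_branch"
proof -
  have comm: "s \<circ> t \<circ> s \<circ> t \<in> left_branch" if s: "s \<in> gens" and t: "t \<in> gens" for s t
  proof -
    have remaining: "u = gen_alpha \<or> u = gen_c0"
      if "u \<in> gens" "u \<notin> {gen_a, gen_c1, gen_c2, gen_c3}" for u
      using that by simp
    show ?thesis
    proof (cases "s \<in> {gen_a, gen_c1, gen_c2, gen_c3}")
      case True
      then show ?thesis using t by (rule generic_commutators_in_left_branch)
    next
      case s': False
      show ?thesis
      proof (cases "t \<in> {gen_a, gen_c1, gen_c2, gen_c3}")
        case True
        then have "t \<circ> s \<circ> t \<circ> s \<in> left_branch"
          using s by (rule generic_commutators_in_left_branch)
        then show ?thesis by (rule commutator_flip_in_left_branch[OF t s])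
      next
        case t': False
        have flipped: "gen_c0 \<circ> gen_alpha \<circ> gen_c0 \<circ> gen_alpha \<in> left_branch"
          by (rule commutator_flip_in_left_branch[OF _ _ alpha_c0_commutator_in_left_branch])
            simp_all
        have "u \<circ> u \<circ> u \<circ> u \<in> left_branch" if "u \<in> gens" for u
          using gens_invol[OF that] K.one_closed by simp
        then show ?thesis
          using alpha_c0_commutator_in_left_branch flipped s t remaining[OF s s'] remaining[OF t t']
          by metis
      qed
    qed
  qed
  have "derived basilica2_group (carrier basilica2_group) \<subseteq> left_branch"
  proof (rule B.derived_subset_of_commuting_generators[OF generate_B _ left_branch_normal])
    show "gens \<subseteq> carrier basilica2_group" using basilica2_gen by auto
  next
    fix s t assume "s \<in> gens" "t \<in> gens"
    then show "s \<otimes>\<^bsub>basilica2_group\<^esub> t \<otimes>\<^bsub>basilica2_group\<^esub> inv\<^bsub>basilica2_group\<^esub> s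
        \<otimes>\<^bsub>basilica2_group\<^esub> inv\<^bsub>basilica2_group\<^esub> t \<in> left_branch"
      using comm by (simp only: B_inv basilica2_gen gens_inv) simp
  qed
  then show ?thesis unfolding derived_B .
qed

lemma derived_branching:
  assumes "x \<in> derived AutT basilica2" "y \<in> derived AutT basilica2"
  shows "wreath x y id \<in> derived AutT basilica2"
proof -
  have x: "wreath x id id \<in> derived AutT basilica2" and y: "wreath y id id \<in> derived AutT basilica2"
    using assms derived_subset_left_branch by (auto simp: left_branch_def)
  have a: "gen_a \<in> basilica2" by (simp add: basilica2_gen)
  have "gen_a \<circ> wreath y id id \<circ> gen_a \<in> derived AutT basilica2"
    using D.inv_op_closed2[of gen_a "wreath y id id"] y a by (simp add: B_inv gens_inv)
  then have "wreath id y id \<in> derived AutT basilica2" by (simp add: conj_gen_a)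
  then have "wreath x id id \<circ> wreath id y id \<in> derived AutT basilica2"
    using D.m_closed[OF x] by simp
  then show ?thesis by (simp add: wreath_comp)
qed

theorem lemma3p3:
  shows "regular_branch_over basilica2 (derived AutT basilica2)"
  unfolding regular_branch_over_def
  using subgroup_basilica2 self_similar_basilica2 spherically_transitive_basilica2
    D.subgroup_axioms derived_nontrivial finite_index_derived derived_branching
  by simp

end
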